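(* Let $q$ be a prime power and let $m,n,d$ be integers with $m \ge n \ge 2$ and $2 \le d \le n$. Then $$\delta_q(n \times m, m(n-d+1), d) \le \delta_q(2 \times m, m, 2)^{(n-d+1)(d-1)} \; \frac{ \binom{2m}{m}_q^{(n-d+1)(d-1)}}{\binom{mn}{m(n-d+1)}_q}.$$
   Context: $\binom{a}{b}_q = \prod_{i=0}^{b-1} \frac{q^a-q^i}{q^b-q^i}$ is the $q$-binomial coefficient. For integers $m\ge s\ge 2$, a (rank-metric) code in $\mathbb{F}_q^{s\times m}$ is a non-zero $\mathbb{F}_q$-linear subspace $\mathcal{C}\le\mathbb{F}_q^{s\times m}$; its minimum distance is $d(\mathcal{C})=\min\{\mathrm{rk}(M) \mid M \in \mathcal{C}, M\ne 0\}$. For $1\le k\le ms$ and $1 \le d \le s$, $$\delta_q(s \times m, k, d):= \frac{|\{\mathcal{C} \le \mathbb{F}_q^{s\times m} \mid \dim(\mathcal{C})=k, \; d(\mathcal{C}) \ge d\}|}{\binom{ms}{k}_q}.$$ *)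

theory Defs
  imports "Jordan_Normal_Form.DL_Rank" "HOL-Library.Cardinality"
begin

text \<open>
  The field with \<open>q\<close> elements is a type \<open>'a\<close> of sort \<open>{field, finite}\<close> with \<open>CARD('a) = q\<close>; the space
  of \<open>s \<times> m\<close> matrices over it is \<^const>\<open>module_mat\<close>, with linear subspaces and dimensions over
  \<^term>\<open>class_ring\<close> as in the theory of vector spaces with explicit carriers.
\<close>

definition q_binomial :: "real \<Rightarrow> nat \<Rightarrow> nat \<Rightarrow> real" where
  "q_binomial q a b = (\<Prod>i<b. (q ^ a - q ^ i) / (q ^ b - q ^ i))"

definition rank_metric_code :: "nat \<Rightarrow> nat \<Rightarrow> 'a::field mat set \<Rightarrow> bool" where
  "rank_metric_code s m C \<longleftrightarrow>
     VectorSpace.subspace class_ring C (module_mat TYPE('a) s m) \<and> C \<noteq> {0\<^sub>m s m}"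

definition code_dim :: "nat \<Rightarrow> nat \<Rightarrow> 'a::field mat set \<Rightarrow> nat" where
  "code_dim s m C = vectorspace.dim class_ring ((module_mat TYPE('a) s m)\<lparr>carrier := C\<rparr>)"

text \<open>Over a finite field and for a code (which is non-zero), the minimum is over a finite non-empty set.\<close>

definition min_distance :: "nat \<Rightarrow> nat \<Rightarrow> 'a::field mat set \<Rightarrow> nat" where
  "min_distance s m C = Min {vec_space.rank s M | M. M \<in> C \<and> M \<noteq> 0\<^sub>m s m}"

text \<open>
  Intended for \<open>1 \<le> k \<le> m * s\<close> and \<open>1 \<le> d \<le> s\<close>. For \<open>k \<ge> 1\<close>, every \<open>k\<close>-dimensional subspace is
  non-zero, so requiring a code rather than just a subspace excludes nothing.
\<close>

definition code_density :: "'a::{field,finite} itself \<Rightarrow> nat \<Rightarrow> nat \<Rightarrow> nat \<Rightarrow> nat \<Rightarrow> real" where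
  "code_density _ s m k d =
     real (card {C :: 'a mat set. rank_metric_code s m C \<and> code_dim s m C = k \<and> min_distance s m C \<ge> d})
     / q_binomial (real CARD('a)) (m * s) k"

lemma vectorspace_module_mat:
  "vectorspace class_ring (module_mat TYPE('a::field) s m)"
proof -
  interpret abelian_group "module_mat TYPE('a) s m" by (rule abelian_group_mat)
  have "\<exists>y. x * y = 1" if "x \<noteq> 0" for x :: 'a
    using that by (intro exI[of _ "inverse x"]) simp
  then show ?thesis
    by unfold_locales (auto simp: module_mat_simps Units_def field_simps intro!: eq_matI)
qed

end

theory Submission
  imports Defs
begin

text \<open>
  Put \<open>k = n - d + 1\<close>. After multiplication by the \<open>q\<close>-binomial coefficients the claim says that the
  number of \<open>m * k\<close>-dimensional codes \<open>C\<close> of \<open>n \<times> m\<close> matrices with distance at least \<open>d\<close> is at most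
  \<open>N ^ (k * (n - k))\<close>, where \<open>N\<close> is the number of \<open>m\<close>-dimensional codes of \<open>2 \<times> m\<close> matrices with
  distance 2. It is proved by an injection from such codes \<open>C\<close> into families of such \<open>2 \<times> m\<close> codes.

  A matrix in \<open>C\<close> whose first \<open>k\<close> rows vanish has rank at most \<open>n - k < d\<close>, hence is zero. By
  counting, \<open>C\<close> is therefore the graph of a linear map from the first \<open>k\<close> rows to the remaining
  \<open>n - k\<close> rows, that is, of an \<open>(n - k) \<times> k\<close> array of linear maps between spaces of row vectors of
  length \<open>m\<close>. For \<open>j < k \<le> i\<close>, the graph of the map that sends row \<open>j\<close> to its contribution to row \<open>i\<close>
  consists of the pairs of rows \<open>j\<close> and \<open>i\<close> of those matrices in \<open>C\<close> whose first \<open>k\<close> rows, except possibly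
  row \<open>j\<close>, vanish. It is a \<open>2 \<times> m\<close> code of dimension \<open>m\<close> and distance 2
  (\<open>row_pair_code_mrd\<close>): if rows \<open>j\<close> and \<open>i\<close> of such a non-zero matrix were dependent, its rank would
  be at most \<open>n - k\<close>. These graphs determine the array, hence \<open>C\<close> (\<open>mrd_codes_subsetI\<close>).

  Dimensions and ranks are handled by cardinalities throughout: a space of dimension \<open>r\<close> over the
  field with \<open>q\<close> elements has \<open>q ^ r\<close> elements.
\<close>

section \<open>Cardinalities of spaces over a finite field\<close>

lemma (in vectorspace) card_eq_power_dim:
  assumes "fin_dim"
  shows "card (carrier V) = card (carrier K) ^ dim"
proof -
  obtain B where B: "finite B" "basis B"
    using finite_basis_exists[OF assms] by blast
  then have sub: "B \<subseteq> carrier V"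
    by (auto simp: basis_def)
  have unique: "\<exists>!a. a \<in> B \<rightarrow>\<^sub>E carrier K \<and> lincomb a B = v" if "v \<in> carrier V" for v
    using basis_criterion[OF B(1) sub] B(2) that by blast
  have closed: "lincomb a B \<in> carrier V" if "a \<in> B \<rightarrow>\<^sub>E carrier K" for a
    using that sub by (intro lincomb_closed) auto
  have "bij_betw (\<lambda>a. lincomb a B) (B \<rightarrow>\<^sub>E carrier K) (carrier V)"
    unfolding bij_betw_def inj_on_def using closed unique by (blast intro: closed)
  then have "card (carrier V) = card (B \<rightarrow>\<^sub>E carrier K)"
    by (rule bij_betw_same_card[symmetric])
  also have "\<dots> = card (carrier K) ^ dim"
    using B by (simp add: card_PiE dim_basis)
  finally show ?thesis .
qed

lemma card_carrier_vec:
  "card (carrier_vec n :: 'a::{field,finite} vec set) = CARD('a) ^ n"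
proof -
  interpret vec_space "TYPE('a)" n .
  show ?thesis using card_eq_power_dim dim_is_n fin_dim by (simp add: class_ring_simps)
qed

lemma finite_carrier_vec: "finite (carrier_vec n :: 'a::{field,finite} vec set)"
  using card_carrier_vec[where 'a='a and n=n] by (intro card_ge_0_finite) simp

lemma finite_carrier_mat: "finite (carrier_mat n m :: 'a::finite mat set)"
proof (rule finite_subset)
  show "carrier_mat n m \<subseteq> mat n m ` (({..<n} \<times> {..<m}) \<rightarrow>\<^sub>E (UNIV :: 'a set))"
  proof
    fix M :: "'a mat" assume "M \<in> carrier_mat n m"
    then have "M = mat n m (restrict (\<lambda>ij. M $$ ij) ({..<n} \<times> {..<m}))" (is "_ = mat n m ?f")
      by (intro eq_matI) auto
    moreover have "?f \<in> ({..<n} \<times> {..<m}) \<rightarrow>\<^sub>E UNIV" by simp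
    ultimately show "M \<in> mat n m ` (({..<n} \<times> {..<m}) \<rightarrow>\<^sub>E UNIV)"
      by (rule image_eqI)
  qed
qed (auto intro!: finite_PiE)

section \<open>Rank bounds by counting column vectors\<close>

text \<open>
  The rank enters the argument only through this count: the column space has \<open>q\<close> to the power of
  the rank many elements.
\<close>

lemma card_mult_mat_vec_image:
  fixes M :: "'a::{field,finite} mat"
  assumes "M \<in> carrier_mat n m"
  shows "card ((\<lambda>x. M *\<^sub>v x) ` carrier_vec m) = CARD('a) ^ vec_space.rank n M"
proof -
  interpret vec_space "TYPE('a)" n .
  have cols: "set (cols M) \<subseteq> carrier_vec n" using assms cols_dim[of M] by auto
  have vs: "vectorspace class_ring (span_vs (set (cols M)))"
    using cols by (intro subspace_is_vs span_is_subspace) auto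
  have "card (col_space M) = CARD('a) ^ rank M"
    using vectorspace.card_eq_power_dim[OF vs fin_dim_span_cols[OF assms]]
    by (simp add: rank_def col_space_def class_ring_simps)
  moreover have "col_space M = (\<lambda>x. M *\<^sub>v x) ` carrier_vec m"
    using assms by (auto simp: col_space_eq[OF assms])
  ultimately show ?thesis by simp
qed

lemma card_field_ge_2: "CARD('a::{field,finite}) \<ge> 2"
proof -
  have "card {0, 1 :: 'a} \<le> CARD('a)" by (intro card_mono) auto
  then show ?thesis by simp
qed

text \<open>
  If the rows indexed by \<open>I\<close> determine the column vectors \<open>M *\<^sub>v x\<close>, then the column space embeds
  into the functions on \<open>I\<close>, and comparing cardinalities bounds the rank.
\<close>

lemma rank_le_card_rows:
  fixes M :: "'a::{field,finite} mat"
  assumes M: "M \<in> carrier_mat n m" and I: "I \<subseteq> {..<n}"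
    and det: "\<And>x. x \<in> carrier_vec m \<Longrightarrow> \<forall>i\<in>I. row M i \<bullet> x = 0 \<Longrightarrow> M *\<^sub>v x = 0\<^sub>v n"
  shows "vec_space.rank n M \<le> card I"
proof -
  let ?R = "(\<lambda>x. M *\<^sub>v x) ` carrier_vec m" and ?coords = "\<lambda>v. restrict (($) v) I"
  have finI: "finite I" using I finite_subset by blast
  have "inj_on ?coords ?R"
  proof (rule inj_onI, clarify)
    fix x y :: "'a vec"
    assume xy: "x \<in> carrier_vec m" "y \<in> carrier_vec m"
      and eq: "?coords (M *\<^sub>v x) = ?coords (M *\<^sub>v y)"
    have diff: "M *\<^sub>v (x - y) = M *\<^sub>v x - M *\<^sub>v y"
      using mult_minus_distrib_mat_vec[OF M xy] .
    have "row M i \<bullet> (x - y) = 0" if "i \<in> I" for i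
    proof -
      have "i < n" using that I by blast
      then have "row M i \<bullet> (x - y) = (M *\<^sub>v x) $ i - (M *\<^sub>v y) $ i"
        using arg_cong[OF diff, of "\<lambda>v. v $ i"] M by simp
      then show ?thesis using fun_cong[OF eq, of i] that by simp
    qed
    then have "M *\<^sub>v (x - y) = 0\<^sub>v n" using xy by (intro det) auto
    then have "(M *\<^sub>v x) $ i - (M *\<^sub>v y) $ i = 0" if "i < n" for i
      using arg_cong[OF diff, of "\<lambda>v. v $ i"] that M by simp
    then show "M *\<^sub>v x = M *\<^sub>v y" using M by (intro eq_vecI) auto
  qed
  then have "card ?R \<le> card (I \<rightarrow>\<^sub>E (UNIV :: 'a set))"
    by (rule card_inj_on_le) (auto intro!: finite_PiE finI)
  then have "CARD('a) ^ vec_space.rank n M \<le> CARD('a) ^ card I"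
    using finI by (simp add: card_mult_mat_vec_image[OF M] card_PiE)
  then show ?thesis
    using card_field_ge_2[where 'a='a] by (simp add: power_le_imp_le_exp)
qed

text \<open>
  For a matrix of rank at most 1 with non-zero first row, choose \<open>x\<close> on which the first row evaluates
  to 1. The \<open>q\<close> multiples of \<open>N *\<^sub>v x\<close> exhaust the column space, so \<open>N *\<^sub>v y\<close> is
  \<open>N *\<^sub>v x\<close> scaled by the value of the first row at \<open>y\<close>; hence the second row is the first one
  scaled by the value of the second row at \<open>x\<close>.
\<close>

lemma second_row_multiple:
  fixes N :: "'a::{field,finite} mat"
  assumes N: "N \<in> carrier_mat 2 m" and "row N 0 \<noteq> 0\<^sub>v m" and "vec_space.rank 2 N \<le> 1"
  obtains c where "row N 1 = c \<cdot>\<^sub>v row N 0"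
proof -
  let ?R = "(\<lambda>x. N *\<^sub>v x) ` carrier_vec m"
  obtain b where b: "b < m" "row N 0 $ b \<noteq> 0"
    using assms by (metis carrier_matD eq_vecI index_zero_vec row_carrier_vec carrier_vecD zero_less_numeral)
  define x where "x = inverse (row N 0 $ b) \<cdot>\<^sub>v unit_vec m b"
  have x: "x \<in> carrier_vec m" by (simp add: x_def)
  have x1: "row N 0 \<bullet> x = 1" using b N by (simp add: x_def)
  have Nx: "N *\<^sub>v (a \<cdot>\<^sub>v x) = a \<cdot>\<^sub>v (N *\<^sub>v x)" for a
    using mult_mat_vec[OF N x] .
  let ?line = "(\<lambda>a. a \<cdot>\<^sub>v (N *\<^sub>v x)) ` UNIV"
  have inj: "inj (\<lambda>a. a \<cdot>\<^sub>v (N *\<^sub>v x))"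
  proof (rule injI)
    fix a a' assume "a \<cdot>\<^sub>v (N *\<^sub>v x) = a' \<cdot>\<^sub>v (N *\<^sub>v x)"
    then have "(a \<cdot>\<^sub>v (N *\<^sub>v x)) $ 0 = (a' \<cdot>\<^sub>v (N *\<^sub>v x)) $ 0" by simp
    then show "a = a'" using N x1 by simp
  qed
  have "card ?R \<le> CARD('a) ^ 1"
    unfolding card_mult_mat_vec_image[OF N] using assms(3) by (intro power_increasing) auto
  moreover have "card ?line = CARD('a)" using inj by (simp add: card_image)
  moreover have "?line \<subseteq> ?R" using x by (auto simp: Nx[symmetric])
  moreover have "finite ?R" using finite_carrier_vec by blast
  ultimately have R: "?R = ?line" by (metis card_seteq power_one_right)
  define c where "c = row N 1 \<bullet> x"
  have *: "row N 1 \<bullet> y = c * (row N 0 \<bullet> y)" if "y \<in> carrier_vec m" for y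
  proof -
    obtain a where a: "N *\<^sub>v y = a \<cdot>\<^sub>v (N *\<^sub>v x)" using R \<open>y \<in> _\<close> by blast
    have "row N i \<bullet> y = a * (row N i \<bullet> x)" if "i < 2" for i
      using arg_cong[OF a, of "\<lambda>v. v $ i"] that N by simp
    from this[of 0] this[of 1] show ?thesis by (simp add: x1 c_def)
  qed
  have "row N 1 = c \<cdot>\<^sub>v row N 0"
  proof (rule eq_vecI)
    fix l assume "l < dim_vec (c \<cdot>\<^sub>v row N 0)"
    then have l: "l < m" using N by simp
    then show "row N 1 $ l = (c \<cdot>\<^sub>v row N 0) $ l"
      using *[of "unit_vec m l"] N by simp
  qed (use N in simp)
  then show ?thesis by (rule that)
qed

section \<open>Codes as sets of matrices\<close>

text \<open>
  A linear subspace of the \<open>s \<times> m\<close> matrices, spelled out by its closure properties; unlike for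
  \<^const>\<open>rank_metric_code\<close>, the zero subspace counts.
\<close>

definition linear_code :: "nat \<Rightarrow> nat \<Rightarrow> 'a::field mat set \<Rightarrow> bool" where
  "linear_code s m C \<longleftrightarrow> C \<subseteq> carrier_mat s m \<and> 0\<^sub>m s m \<in> C \<and>
     (\<forall>M\<in>C. \<forall>N\<in>C. M + N \<in> C) \<and> (\<forall>a. \<forall>M\<in>C. a \<cdot>\<^sub>m M \<in> C)"

lemma subspace_module_mat_iff:
  "VectorSpace.subspace class_ring C (module_mat TYPE('a::field) s m) \<longleftrightarrow> linear_code s m C"
  using vectorspace_module_mat[where 'a='a and s=s and m=m]
  by (auto simp: VectorSpace.subspace_def submodule_def linear_code_def module_mat_simps
      class_ring_simps vectorspace_def)

lemma card_linear_code:
  fixes C :: "'a::{field,finite} mat set"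
  assumes "linear_code s m C"
  shows "card C = CARD('a) ^ code_dim s m C"
proof -
  interpret MV: vectorspace class_ring "module_mat TYPE('a) s m" by (rule vectorspace_module_mat)
  interpret W: vectorspace class_ring "(module_mat TYPE('a) s m)\<lparr>carrier := C\<rparr>"
    using assms by (intro MV.subspace_is_vs) (simp add: subspace_module_mat_iff)
  have "finite C"
    using assms finite_carrier_mat finite_subset unfolding linear_code_def by blast
  moreover have "W.span C = C"
    using W.in_own_span[of C] W.span_is_subset2[of C] by auto
  ultimately have W.fin_dim unfolding W.fin_dim_def by (intro exI[of _ C]) auto
  then show ?thesis using W.card_eq_power_dim by (simp add: code_dim_def class_ring_simps)
qed

text \<open>
  Dimension becomes cardinality and the minimum becomes a bound on every non-zero matrix. Since
  \<open>k \<ge> 1\<close>, the zero subspace satisfies neither side.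
\<close>

lemma code_iff:
  fixes C :: "'a::{field,finite} mat set"
  assumes "k \<ge> 1"
  shows "rank_metric_code s m C \<and> code_dim s m C = k \<and> min_distance s m C \<ge> d \<longleftrightarrow>
    linear_code s m C \<and> card C = CARD('a) ^ k \<and>
    (\<forall>M\<in>C. M \<noteq> 0\<^sub>m s m \<longrightarrow> d \<le> vec_space.rank s M)"
proof (cases "linear_code s m C")
  case lin: True
  have fin: "finite C"
    using lin finite_carrier_mat finite_subset unfolding linear_code_def by blast
  have dim: "card C = CARD('a) ^ k \<longleftrightarrow> code_dim s m C = k"
    using card_field_ge_2[where 'a='a] by (simp add: card_linear_code[OF lin])
  have "min_distance s m C \<ge> d \<longleftrightarrow> (\<forall>M\<in>C. M \<noteq> 0\<^sub>m s m \<longrightarrow> d \<le> vec_space.rank s M)"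
    if "C \<noteq> {0\<^sub>m s m}"
  proof -
    have "{vec_space.rank s M |M. M \<in> C \<and> M \<noteq> 0\<^sub>m s m} \<noteq> {}"
      using that lin unfolding linear_code_def by blast
    then show ?thesis unfolding min_distance_def using fin by (subst Min_ge_iff) auto
  qed
  moreover have "card C \<noteq> CARD('a) ^ k" if "C = {0\<^sub>m s m}"
    using that assms card_field_ge_2[where 'a='a] one_less_power[of "CARD('a)" k] by simp
  ultimately show ?thesis
    using lin dim unfolding rank_metric_code_def subspace_module_mat_iff by metis
qed (simp add: rank_metric_code_def subspace_module_mat_iff)

lemma linear_code_minus:
  fixes C :: "'a::field mat set"
  assumes C: "linear_code s m C" and "M \<in> C" "N \<in> C"
  shows "M - N \<in> C"
proof -
  have "M - N = M + (-1) \<cdot>\<^sub>m N"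
    using assms by (intro eq_matI) (auto simp: linear_code_def)
  then show ?thesis using assms by (simp add: linear_code_def)
qed

section \<open>Maximum rank distance codes and their pairs of rows\<close>

text \<open>
  The maximum rank distance codes of dimension \<open>m * k\<close>, the dimension being expressed by the
  cardinality. Their non-zero elements have rank at least \<open>n - k + 1\<close>, which for
  \<open>1 \<le> k \<le> n \<le> m\<close> is the largest minimum distance that the Singleton bound permits.
\<close>

definition mrd_codes :: "nat \<Rightarrow> nat \<Rightarrow> nat \<Rightarrow> 'a::{field,finite} mat set set" where
  "mrd_codes n m k = {C. linear_code n m C \<and> card C = CARD('a) ^ (m * k) \<and>
     (\<forall>M\<in>C. M \<noteq> 0\<^sub>m n m \<longrightarrow> n - k < vec_space.rank n M)}"

text \<open>
  The \<open>2 \<times> m\<close> matrix whose rows are the rows \<open>j\<close> and \<open>i\<close> of \<open>M\<close>, in this order.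
\<close>

definition row_pair :: "nat \<Rightarrow> nat \<Rightarrow> nat \<Rightarrow> 'a mat \<Rightarrow> 'a mat" where
  "row_pair m j i M = mat 2 m (\<lambda>(r, c). M $$ (if r = 0 then j else i, c))"

text \<open>
  Among the first \<open>k\<close> rows of \<open>M\<close>, at most row \<open>j\<close> is non-zero; the rows from \<open>k\<close> on are
  arbitrary.
\<close>

definition row_supported :: "nat \<Rightarrow> nat \<Rightarrow> nat \<Rightarrow> 'a::zero mat \<Rightarrow> bool" where
  "row_supported m k j M \<longleftrightarrow> (\<forall>l<k. l \<noteq> j \<longrightarrow> row M l = 0\<^sub>v m)"

lemma row_minus:
  assumes "A \<in> carrier_mat n m" "B \<in> carrier_mat n m" "i < n"
  shows "row (A - B) i = row A i - row B i"
  using assms by (intro eq_vecI) auto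

lemma row_in_carrier_vec: "M \<in> carrier_mat n m \<Longrightarrow> row M i \<in> carrier_vec m"
  by auto

lemma row_pair_carrier [simp]: "row_pair m j i M \<in> carrier_mat 2 m"
  by (simp add: row_pair_def)

lemma row_row_pair:
  assumes "M \<in> carrier_mat n m" "j < n" "i < n"
  shows "row (row_pair m j i M) 0 = row M j" "row (row_pair m j i M) 1 = row M i"
  using assms by (auto intro!: eq_vecI simp: row_pair_def)

lemma finite_mrd_codes: "finite (mrd_codes n m k)"
proof (rule finite_subset)
  show "mrd_codes n m k \<subseteq> Pow (carrier_mat n m)"
    by (auto simp: mrd_codes_def linear_code_def)
qed (simp add: finite_carrier_mat)

context
  fixes n m k :: nat and C :: "'a::{field,finite} mat set"
  assumes C: "C \<in> mrd_codes n m k" and k: "k \<le> n"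
begin

lemma mrd_linear: "linear_code n m C"
  using C by (simp add: mrd_codes_def)

lemma mrd_carrier: "M \<in> C \<Longrightarrow> M \<in> carrier_mat n m"
  using mrd_linear by (auto simp: linear_code_def)

text \<open>
  The first \<open>k\<close> rows of a matrix in the code determine it: if they vanish, only \<open>n - k\<close> rows
  are left, too few for the rank of a non-zero element.
\<close>

lemma mrd_eq_zeroI:
  assumes "M \<in> C" and "\<And>l. l < k \<Longrightarrow> row M l = 0\<^sub>v m"
  shows "M = 0\<^sub>m n m"
proof (rule ccontr)
  assume "M \<noteq> 0\<^sub>m n m"
  then have "n - k < vec_space.rank n M" using C assms(1) by (simp add: mrd_codes_def)
  moreover have "vec_space.rank n M \<le> card {k..<n}"
  proof (rule rank_le_card_rows[OF mrd_carrier[OF assms(1)]])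
    fix x :: "'a vec" assume "x \<in> carrier_vec m" "\<forall>i\<in>{k..<n}. row M i \<bullet> x = 0"
    then have "row M i \<bullet> x = 0" if "i < n" for i
      using assms(2)[of i] that by (cases "i < k") auto
    then show "M *\<^sub>v x = 0\<^sub>v n" using mrd_carrier[OF assms(1)] by (intro eq_vecI) auto
  qed auto
  ultimately show False by simp
qed

lemma mrd_eqI:
  assumes "M \<in> C" "N \<in> C" and "\<And>l. l < k \<Longrightarrow> row M l = row N l"
  shows "M = N"
proof -
  have "row (M - N) l = 0\<^sub>v m" if "l < k" for l
    using that assms(3)[OF that] k row_minus[OF mrd_carrier mrd_carrier, OF assms(1,2), of l]
      minus_cancel_vec[OF row_in_carrier_vec[OF mrd_carrier[OF assms(2)]]] by simp
  then have z: "M - N = 0\<^sub>m n m"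
    using mrd_eq_zeroI linear_code_minus[OF mrd_linear] assms by blast
  have "M $$ (i, j) - N $$ (i, j) = 0" if "i < n" "j < m" for i j
    using arg_cong[OF z, of "\<lambda>A. A $$ (i, j)"] that
      mrd_carrier[OF assms(1)] mrd_carrier[OF assms(2)] by simp
  then show ?thesis using mrd_carrier[OF assms(1)] mrd_carrier[OF assms(2)] by (intro eq_matI) auto
qed

text \<open>
  The first \<open>k\<close> rows can be prescribed arbitrarily: taking them is an injective map from the code to
  a set of the same cardinality.
\<close>

lemma mrd_exists_rows:
  assumes "\<And>l. l < k \<Longrightarrow> f l \<in> carrier_vec m"
  shows "\<exists>M\<in>C. \<forall>l<k. row M l = f l"
proof -
  let ?rows = "\<lambda>M. restrict (row M) {..<k}"
  let ?F = "{..<k} \<rightarrow>\<^sub>E (carrier_vec m :: 'a vec set)"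
  have finF: "finite ?F" using finite_carrier_vec by (intro finite_PiE) auto
  have "inj_on ?rows C"
  proof (rule inj_onI)
    fix M N assume "M \<in> C" "N \<in> C" and eq: "?rows M = ?rows N"
    moreover have "row M l = row N l" if "l < k" for l
      using fun_cong[OF eq, of l] that by simp
    ultimately show "M = N" by (intro mrd_eqI)
  qed
  then have "card (?rows ` C) = card ?F"
    using C by (simp add: card_image mrd_codes_def card_PiE card_carrier_vec power_mult)
  moreover have "?rows ` C \<subseteq> ?F" using row_in_carrier_vec[OF mrd_carrier] by auto
  ultimately have "?rows ` C = ?F" using finF by (simp add: card_subset_eq)
  moreover have "restrict f {..<k} \<in> ?F" using assms by auto
  ultimately obtain M where M: "M \<in> C" "restrict f {..<k} = ?rows M" by blast
  have "row M l = f l" if "l < k" for l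
    using fun_cong[OF M(2), of l] that by simp
  then show ?thesis using M(1) by blast
qed

lemma mrd_exists_supported:
  assumes "v \<in> carrier_vec m"
  shows "\<exists>M\<in>C. row_supported m k j M \<and> (j < k \<longrightarrow> row M j = v)"
  using mrd_exists_rows[of "\<lambda>l. if l = j then v else 0\<^sub>v m"] assms
  unfolding row_supported_def by fastforce

lemma mrd_supported_eqI:
  assumes "M \<in> C" "N \<in> C" "row_supported m k j M" "row_supported m k j N" "row M j = row N j"
  shows "M = N"
proof (rule mrd_eqI)
  show "row M l = row N l" if "l < k" for l
    using assms that by (cases "l = j") (auto simp: row_supported_def)
qed (use assms in auto)

text \<open>
  If rows \<open>j\<close> and \<open>i\<close> were dependent, row \<open>i\<close> would be a multiple of the non-zero row \<open>j\<close>. Row \<open>j\<close>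
  and the \<open>n - k - 1\<close> rows \<open>l \<ge> k\<close> with \<open>l \<noteq> i\<close> would then determine the column
  space, so the rank of \<open>M\<close> would be at most \<open>n - k\<close>.
\<close>

lemma rank_row_pair:
  assumes M: "M \<in> C" "row_supported m k j M" "M \<noteq> 0\<^sub>m n m" and ji: "j < k" "k \<le> i" "i < n"
  shows "2 \<le> vec_space.rank 2 (row_pair m j i M)"
proof (rule ccontr)
  assume "\<not> 2 \<le> vec_space.rank 2 (row_pair m j i M)"
  then have r: "vec_space.rank 2 (row_pair m j i M) \<le> 1" by simp
  have row: "row (row_pair m j i M) 0 = row M j" "row (row_pair m j i M) 1 = row M i"
    using row_row_pair[OF mrd_carrier[OF M(1)]] ji k by auto
  have "row M j \<noteq> 0\<^sub>v m"
    using M mrd_eq_zeroI unfolding row_supported_def by metis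
  then obtain c where c: "row M i = c \<cdot>\<^sub>v row M j"
    using second_row_multiple[OF row_pair_carrier _ r] unfolding row by metis
  let ?I = "insert j ({k..<n} - {i})"
  have "vec_space.rank n M \<le> card ?I"
  proof (rule rank_le_card_rows[OF mrd_carrier[OF M(1)]])
    fix x :: "'a vec" assume x: "x \<in> carrier_vec m" and 0: "\<forall>l\<in>?I. row M l \<bullet> x = 0"
    have "row M l \<bullet> x = 0" if l: "l < n" for l
    proof -
      consider "l \<in> ?I" | "l = i" | "l < k" "l \<noteq> j" using l by fastforce
      then show ?thesis
      proof cases
        case 2
        have "row M j \<in> carrier_vec m" using mrd_carrier[OF M(1)] by (rule row_in_carrier_vec)
        then show ?thesis using 0 x by (simp add: 2 c)
      next
        case 3
        then show ?thesis using M(2) x by (simp add: row_supported_def)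
      qed (use 0 in blast)
    qed
    then show "M *\<^sub>v x = 0\<^sub>v n" using mrd_carrier[OF M(1)] by (intro eq_vecI) auto
  qed (use ji in auto)
  also have "card ?I = n - k" using ji by simp
  finally have "vec_space.rank n M \<le> n - k" .
  moreover have "n - k < vec_space.rank n M" using C M(1,3) unfolding mrd_codes_def by blast
  ultimately show False by simp
qed

text \<open>
  The pair codes have dimension \<open>m\<close>: row \<open>j\<close> of a matrix in \<open>C\<close> supported on row \<open>j\<close> can be any
  vector of length \<open>m\<close>, and it determines the matrix.
\<close>

lemma row_pair_code_mrd:
  assumes ji: "j < k" "k \<le> i" "i < n"
  shows "row_pair m j i ` {M \<in> C. row_supported m k j M} \<in> mrd_codes 2 m 1"
proof -
  let ?S = "{M \<in> C. row_supported m k j M}" and ?p = "row_pair m j i"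
  have jn: "j < n" using ji by simp
  have S: "linear_code n m ?S"
  proof -
    have "row_supported m k j (M + N)" if "M \<in> ?S" "N \<in> ?S" for M N
      using that k mrd_carrier[of M] mrd_carrier[of N] by (auto simp: row_supported_def)
    moreover have "row_supported m k j (a \<cdot>\<^sub>m M)" if "M \<in> ?S" for a M
      using that k mrd_carrier[of M] by (auto simp: row_supported_def)
    moreover have "row_supported m k j (0\<^sub>m n m)" using k by (simp add: row_supported_def)
    ultimately show ?thesis using mrd_linear unfolding linear_code_def by blast
  qed
  have padd: "?p M + ?p N = ?p (M + N)" if "M \<in> ?S" "N \<in> ?S" for M N
    using that ji jn mrd_carrier[of M] mrd_carrier[of N] by (intro eq_matI) (auto simp: row_pair_def)
  have psmult: "a \<cdot>\<^sub>m ?p M = ?p (a \<cdot>\<^sub>m M)" if "M \<in> ?S" for a M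
    using that ji jn mrd_carrier[of M] by (intro eq_matI) (auto simp: row_pair_def)
  have pzero: "?p (0\<^sub>m n m) = 0\<^sub>m 2 m"
    using ji jn by (intro eq_matI) (auto simp: row_pair_def)
  have lin_p: "linear_code 2 m (?p ` ?S)"
    unfolding linear_code_def
  proof (intro conjI ballI allI)
    have "0\<^sub>m n m \<in> ?S" using S by (simp only: linear_code_def)
    then have "?p (0\<^sub>m n m) \<in> ?p ` ?S" by (rule imageI)
    then show "0\<^sub>m 2 m \<in> ?p ` ?S" by (simp only: pzero)
    fix M' assume "M' \<in> ?p ` ?S"
    then obtain M where M: "M \<in> ?S" "M' = ?p M" by (rule imageE)
    show "a \<cdot>\<^sub>m M' \<in> ?p ` ?S" for a
    proof -
      have "a \<cdot>\<^sub>m M \<in> ?S" using S M(1) by (simp only: linear_code_def)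
      then show ?thesis unfolding M(2) psmult[OF M(1)] by (rule imageI)
    qed
    fix N' assume "N' \<in> ?p ` ?S"
    then obtain N where N: "N \<in> ?S" "N' = ?p N" by (rule imageE)
    have "M + N \<in> ?S" using S M(1) N(1) by (simp only: linear_code_def)
    then show "M' + N' \<in> ?p ` ?S" unfolding M(2) N(2) padd[OF M(1) N(1)] by (rule imageI)
  qed auto
  have row_eq: "row M j = row N j" if "M \<in> ?S" "N \<in> ?S" "?p M = ?p N" for M N
    using that row_row_pair(1)[OF mrd_carrier[of M] jn ji(3)] row_row_pair(1)[OF mrd_carrier[of N] jn ji(3)]
    by simp
  have inj: "inj_on ?p ?S"
    using row_eq by (intro inj_onI) (auto intro!: mrd_supported_eqI[of _ _ j])
  have "bij_betw (\<lambda>M. row M j) ?S (carrier_vec m)"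
    unfolding bij_betw_def
  proof
    show "inj_on (\<lambda>M. row M j) ?S"
      by (intro inj_onI) (auto intro!: mrd_supported_eqI[of _ _ j])
    show "(\<lambda>M. row M j) ` ?S = carrier_vec m"
    proof (intro equalityI subsetI)
      fix v assume "v \<in> (\<lambda>M. row M j) ` ?S"
      then obtain M where "M \<in> C" "v = row M j" by blast
      then show "v \<in> carrier_vec m" using row_in_carrier_vec[OF mrd_carrier] by blast
    next
      fix v :: "'a vec" assume "v \<in> carrier_vec m"
      then obtain M where "M \<in> ?S" "row M j = v"
        using mrd_exists_supported[of v j] ji by auto
      then show "v \<in> (\<lambda>M. row M j) ` ?S" by blast
    qed
  qed
  then have "card ?S = card (carrier_vec m :: 'a vec set)" by (rule bij_betw_same_card)
  then have "card ?S = CARD('a) ^ m" by (simp add: card_carrier_vec)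
  then have card: "card (?p ` ?S) = CARD('a) ^ (m * 1)" by (simp add: card_image[OF inj])
  have "2 - 1 < vec_space.rank 2 M'" if M': "M' \<in> ?p ` ?S" "M' \<noteq> 0\<^sub>m 2 m" for M'
  proof -
    obtain M where M: "M \<in> ?S" "M' = ?p M" using M' by blast
    then have "M \<noteq> 0\<^sub>m n m" using pzero M' by auto
    then show ?thesis using rank_row_pair[of M j i] M ji by simp
  qed
  then show ?thesis using lin_p card unfolding mrd_codes_def by blast
qed

text \<open>
  The code is spanned by its matrices supported on a single one of the first \<open>k\<close> rows.
\<close>

lemma mrd_subset:
  assumes C': "linear_code n m C'" and sub: "\<And>j. j < k \<Longrightarrow> {M \<in> C. row_supported m k j M} \<subseteq> C'"
  shows "C \<subseteq> C'"
proof -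
  \<comment> \<open>Induction on the bound \<open>t\<close> below which the non-zero ones among the first \<open>k\<close> rows lie.\<close>
  have "M \<in> C'" if "t \<le> k" "M \<in> C" "\<forall>l<k. t \<le> l \<longrightarrow> row M l = 0\<^sub>v m" for t M
    using that
  proof (induction t arbitrary: M)
    case 0
    then have "M = 0\<^sub>m n m" by (intro mrd_eq_zeroI) auto
    then show ?case using C' by (simp add: linear_code_def)
  next
    case (Suc t)
    have t: "t < k" using Suc.prems by simp
    have Mc: "M \<in> carrier_mat n m" using Suc.prems mrd_carrier by simp
    then have "row M t \<in> carrier_vec m" by (rule row_in_carrier_vec)
    then obtain N where N: "N \<in> C" "row_supported m k t N" "row N t = row M t"
      using mrd_exists_supported[of "row M t" t] t by auto
    then have NC': "N \<in> C'" using sub[OF t] by blast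
    have Nc: "N \<in> carrier_mat n m" using N mrd_carrier by simp
    have "M - N \<in> C'"
    proof (rule Suc.IH)
      show "M - N \<in> C" using linear_code_minus[OF mrd_linear] Suc.prems N by blast
      show "\<forall>l<k. t \<le> l \<longrightarrow> row (M - N) l = 0\<^sub>v m"
      proof (intro allI impI)
        fix l assume l: "l < k" "t \<le> l"
        have "row (M - N) l = row M l - row N l" using row_minus[OF Mc Nc] l k by simp
        also have "\<dots> = 0\<^sub>v m"
          using N(2,3) Suc.prems(3) l Mc
          by (cases "l = t") (auto simp: row_supported_def)
        finally show "row (M - N) l = 0\<^sub>v m" .
      qed
    qed (use t in simp)
    then have "(M - N) + N \<in> C'" using C' NC' by (simp add: linear_code_def)
    moreover have "(M - N) + N = M" using Mc Nc by (intro eq_matI) auto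
    ultimately show ?case by simp
  qed
  then show ?thesis by (meson leD order_refl subsetI)
qed

end

text \<open>
  The pair codes determine the code; the two inclusions are symmetric. For \<open>M\<close> in \<open>C\<close> supported on row \<open>j\<close>, let \<open>N\<close> be the matrix in
  \<open>C'\<close> supported on row \<open>j\<close> with the same row \<open>j\<close>; equality of the pair codes forces \<open>M\<close> and \<open>N\<close> to
  agree in every row \<open>i \<ge> k\<close>.
\<close>

lemma mrd_codes_subsetI:
  fixes C C' :: "'a::{field,finite} mat set"
  assumes C: "C \<in> mrd_codes n m k" and C': "C' \<in> mrd_codes n m k" and k: "k < n"
    and eq: "\<And>j i. j < k \<Longrightarrow> k \<le> i \<Longrightarrow> i < n \<Longrightarrow>
      row_pair m j i ` {M \<in> C. row_supported m k j M} = row_pair m j i ` {M \<in> C'. row_supported m k j M}"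
  shows "C \<subseteq> C'"
proof (rule mrd_subset[OF C])
  fix j assume j: "j < k"
  show "{M \<in> C. row_supported m k j M} \<subseteq> C'"
  proof (intro subsetI)
    fix M assume M: "M \<in> {M \<in> C. row_supported m k j M}"
    have Mc: "M \<in> carrier_mat n m" using mrd_carrier[OF C] k M by simp
    then have "row M j \<in> carrier_vec m" by (rule row_in_carrier_vec)
    then obtain N where N: "N \<in> C'" "row_supported m k j N" "row N j = row M j"
      using mrd_exists_supported[OF C', of "row M j" j] j k by auto
    have Nc: "N \<in> carrier_mat n m" using mrd_carrier[OF C'] k N by simp
    have "row M i = row N i" if i: "k \<le> i" "i < n" for i
    proof -
      obtain N' where N': "N' \<in> C'" "row_supported m k j N'" "row_pair m j i M = row_pair m j i N'"
        using eq[OF j i] M by blast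
      have N'c: "N' \<in> carrier_mat n m" using mrd_carrier[OF C'] k N' by simp
      have "row N' j = row M j" "row N' i = row M i"
        using row_row_pair[OF Mc, of j i] row_row_pair[OF N'c, of j i] N'(3) i j by auto
      then show ?thesis
        using mrd_supported_eqI[OF C' _ N'(1) N(1) N'(2) N(2)] N(3) k by simp
    qed
    moreover have "row M l = row N l" if "l < k" for l
      using N(2,3) M that by (cases "l = j") (auto simp: row_supported_def)
    ultimately have "row M l = row N l" if "l < n" for l
      using that by (cases "l < k") auto
    then have "M = N" using Mc Nc by (intro eq_rowI) auto
    then show "M \<in> C'" using N by simp
  qed
next
  show "linear_code n m C'" using C' by (simp add: mrd_codes_def)
qed (use k in simp)

section \<open>Counting maximum rank distance codes\<close>

lemma card_mrd_codes_le:
  assumes k: "k < n"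
  shows "card (mrd_codes n m k :: 'a::{field,finite} mat set set)
    \<le> card (mrd_codes 2 m 1 :: 'a mat set set) ^ (k * (n - k))"
proof -
  let ?I = "{..<k} \<times> {k..<n}"
  let ?T = "?I \<rightarrow>\<^sub>E (mrd_codes 2 m 1 :: 'a mat set set)"
  let ?\<Phi> = "\<lambda>C :: 'a mat set. \<lambda>(j, i)\<in>?I. row_pair m j i ` {M \<in> C. row_supported m k j M}"
  have "card (mrd_codes n m k :: 'a mat set set) \<le> card ?T"
  proof (rule card_inj_on_le[of ?\<Phi>])
    show "inj_on ?\<Phi> (mrd_codes n m k)"
    proof (rule inj_onI)
      fix C C' :: "'a mat set"
      assume C: "C \<in> mrd_codes n m k" "C' \<in> mrd_codes n m k" and eq: "?\<Phi> C = ?\<Phi> C'"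
      have family_eq: "row_pair m j i ` {M \<in> C. row_supported m k j M} =
          row_pair m j i ` {M \<in> C'. row_supported m k j M}"
        if "j < k" "k \<le> i" "i < n" for j i
        using fun_cong[OF eq, of "(j, i)"] that by simp
      show "C = C'"
      proof (rule equalityI)
        show "C \<subseteq> C'" using family_eq by (rule mrd_codes_subsetI[OF C k])
        show "C' \<subseteq> C" using family_eq[symmetric] by (rule mrd_codes_subsetI[OF C(2,1) k])
      qed
    qed
    show "?\<Phi> ` mrd_codes n m k \<subseteq> ?T"
    proof (rule image_subsetI)
      fix C :: "'a mat set" assume "C \<in> mrd_codes n m k"
      then have "(case ji of (j, i) \<Rightarrow> row_pair m j i ` {M \<in> C. row_supported m k j M}) \<in> mrd_codes 2 m 1"
        if "ji \<in> ?I" for ji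
        using row_pair_code_mrd[of C n m k] k that by (cases ji) simp
      then show "?\<Phi> C \<in> ?T" by (rule restrict_PiE_iff[THEN iffD2, OF ballI])
    qed
    show "finite ?T" by (intro finite_PiE) (auto simp: finite_mrd_codes)
  qed
  also have "card ?T = card (mrd_codes 2 m 1 :: 'a mat set set) ^ (k * (n - k))"
    by (simp add: card_PiE)
  finally show ?thesis .
qed

lemma q_binomial_pos:
  assumes "1 < q" and "b \<le> a"
  shows "0 < q_binomial q a b"
  unfolding q_binomial_def
  using assms by (intro prod_pos) (auto intro!: divide_pos_pos power_strict_increasing)

lemma code_density_mrd:
  assumes "1 \<le> k" "k \<le> n" "1 \<le> m" "d = n - k + 1"
  shows "code_density TYPE('a::{field,finite}) n m (m * k) d =
    real (card (mrd_codes n m k :: 'a mat set set)) / q_binomial (real CARD('a)) (m * n) (m * k)"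
proof -
  have k1: "1 \<le> m * k" using assms by simp
  show ?thesis
    unfolding code_density_def mrd_codes_def code_iff[OF k1]
    using assms by (simp add: Suc_le_eq)
qed

theorem corollary7p5:
  fixes q m n d :: nat
  assumes "CARD('a::{field,finite}) = q"
    and "m \<ge> n" and "n \<ge> 2" and "2 \<le> d" and "d \<le> n"
  shows "code_density TYPE('a) n m (m * (n - d + 1)) d
    \<le> code_density TYPE('a) 2 m m 2 ^ ((n - d + 1) * (d - 1))
        * (q_binomial (real q) (2 * m) m ^ ((n - d + 1) * (d - 1))
           / q_binomial (real q) (m * n) (m * (n - d + 1)))"
proof -
  define k where "k = n - d + 1"
  have k: "1 \<le> k" "k < n" "d = n - k + 1" "n - k = d - 1" and m: "1 \<le> m"
    using assms by (auto simp: k_def)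
  let ?B = "q_binomial (real q) (m * n) (m * k)" and ?B2 = "q_binomial (real q) (2 * m) m"
  let ?e = "k * (d - 1)"
  let ?N = "real (card (mrd_codes 2 m 1 :: 'a mat set set))"
  have q: "1 < real q" using card_field_ge_2[where 'a='a] assms(1) by simp
  have B: "0 < ?B" and B2: "0 < ?B2" using q k(2) by (auto intro!: q_binomial_pos)
  have "code_density TYPE('a) n m (m * k) d = real (card (mrd_codes n m k :: 'a mat set set)) / ?B"
    using code_density_mrd[OF k(1) less_imp_le[OF k(2)] m k(3), where 'a='a]
    unfolding assms(1) .
  also have "\<dots> \<le> ?N ^ ?e / ?B"
    using card_mrd_codes_le[OF k(2), of m, where 'a='a] B
    by (intro divide_right_mono) (simp_all flip: of_nat_power add: k(4))
  also have "\<dots> = (?N / ?B2) ^ ?e * (?B2 ^ ?e / ?B)"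
    using B2 by (simp add: power_divide)
  also have "?N / ?B2 = code_density TYPE('a) 2 m m 2"
    using code_density_mrd[of 1 2 m 2, where 'a='a] m assms(1) by (simp add: mult.commute)
  finally show ?thesis by (simp add: k_def)
qed

end
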